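(* Let $f \ge 1$ and $n \le 5f$. Consider $n$ robots on the real line in the ATOM model under a fully asynchronous scheduler, where up to $f$ robots may be Byzantine. Then no deterministic cautious algorithm solves Byzantine convergence. Byzantine convergence requires that for every $\epsilon>0$ there is a time $t_\epsilon$ such that for all $t>t_\epsilon$ all correct robots are pairwise within distance $\epsilon$.
   Context: Model: $n$ robots are located on the real line, and at most $f$ of them are Byzantine (arbitrary behaviour, positions chosen by an adversary). Robots are anonymous (same deterministic program), oblivious, have no common orientation, and have unlimited visibility with strong multiplicity detection (an observation returns the multiset of all positions). Each correct robot performs Look–Compute–Move cycles. In a Move, the adversary may stop robot $i$ before its destination, but only after it has moved at least $\delta_i>0$ toward it (or reached it). In the ATOM model, each activated robot performs a full cycle atomically: the execution is a sequence of rounds, in each of which a subset of robots chosen by the scheduler perform complete cycles. A fully asynchronous scheduler only guarantees that each robot is activated infinitely often. Cautious algorithm: let $D_i(t)$ be the last destination computed by robot $i$ at or before $t$, and let $U^i(t)$ be the positions of the correct robots as seen in robot $i$'s last observation. The algorithm is cautious if both of the following hold: - for all $t$ and every correct robot $i$, $D_i(t) \in range(U^i(t)) = [\min U^i(t), \max U^i(t)]$; - whenever the correct robots are not all at one point at time $t$, some correct robot $i$ at some later time $t'$ has $D_i(t') \neq U_i(t')$, where $U_i(t')$ is its position.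
   Formalization: The formal theorem additionally assumes n ≥ 2; for n = 1 the claim as stated fails, since a single robot that never moves is cautious and converges trivially (and n = 0 is vacuous). *)

theory Defs
  imports Complex_Main "HOL-Library.Multiset"
begin

text \<open>
  Model (ATOM, fully asynchronous).  Robots are indexed by 0..n-1.
  An algorithm is a single (anonymous, deterministic, oblivious) function
  mapping the observed multiset of positions, expressed in the robot's local
  frame (origin at the robot itself, orientation sigma i in {1,-1} chosen by
  the adversary), to a destination in that local frame.
  Time is discrete: pos t j is the position of robot j at the beginning of
  round t; S t is the set of robots activated in round t.
\<close>

type_synonym algorithm = "real multiset \<Rightarrow> real"

definition config :: "nat \<Rightarrow> (nat \<Rightarrow> real) \<Rightarrow> real multiset" where
  "config n p = image_mset p (mset_set {..<n})"

definition local_view :: "nat \<Rightarrow> (nat \<Rightarrow> real) \<Rightarrow> real \<Rightarrow> nat \<Rightarrow> real multiset" where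
  "local_view n p s i = image_mset (\<lambda>x. s * (x - p i)) (config n p)"

definition dest :: "algorithm \<Rightarrow> nat \<Rightarrow> (nat \<Rightarrow> real) \<Rightarrow> real \<Rightarrow> nat \<Rightarrow> real" where
  "dest A n p s i = p i + s * A (local_view n p s i)"

text \<open>An execution of algorithm A with n robots, at most f Byzantine (set B),
  minimal move distances delta, local orientations sigma, activation schedule S,
  and positions pos.  Byzantine positions are unconstrained.\<close>
definition execution ::
  "algorithm \<Rightarrow> nat \<Rightarrow> nat \<Rightarrow> nat set \<Rightarrow> (nat \<Rightarrow> real) \<Rightarrow> (nat \<Rightarrow> real)
     \<Rightarrow> (nat \<Rightarrow> nat set) \<Rightarrow> (nat \<Rightarrow> nat \<Rightarrow> real) \<Rightarrow> bool" where
  "execution A n f B delta sigma S pos \<longleftrightarrow>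
     B \<subseteq> {..<n} \<and> card B \<le> f \<and>
     (\<forall>i<n. delta i > 0) \<and>
     (\<forall>i<n. sigma i = 1 \<or> sigma i = -1) \<and>
     (\<forall>t. S t \<subseteq> {..<n}) \<and>
     (\<forall>i<n. \<forall>t. \<exists>t'\<ge>t. i \<in> S t') \<and>
     (\<forall>t. \<forall>i<n. i \<notin> B \<longrightarrow>
        (if i \<in> S t then
           (let p = pos t i; d = dest A n (pos t) (sigma i) i; q = pos (Suc t) i in
              min p d \<le> q \<and> q \<le> max p d \<and> (q = d \<or> \<bar>q - p\<bar> \<ge> delta i))
         else pos (Suc t) i = pos t i))"

definition correct_positions :: "nat \<Rightarrow> nat set \<Rightarrow> (nat \<Rightarrow> real) \<Rightarrow> real set" where
  "correct_positions n B p = p ` ({..<n} - B)"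

definition cautious :: "algorithm \<Rightarrow> nat \<Rightarrow> nat \<Rightarrow> bool" where
  "cautious A n f \<longleftrightarrow>
     (\<forall>B delta sigma S pos. execution A n f B delta sigma S pos \<longrightarrow>
        (\<forall>t. \<forall>i<n. i \<notin> B \<longrightarrow> i \<in> S t \<longrightarrow>
           dest A n (pos t) (sigma i) i \<in>
             {Min (correct_positions n B (pos t)) .. Max (correct_positions n B (pos t))}) \<and>
        (\<forall>t. (\<exists>j<n. \<exists>k<n. j \<notin> B \<and> k \<notin> B \<and> pos t j \<noteq> pos t k) \<longrightarrow>
           (\<exists>t'\<ge>t. \<exists>i<n. i \<notin> B \<and> i \<in> S t' \<and> dest A n (pos t') (sigma i) i \<noteq> pos t' i)))"

definition solves_convergence :: "algorithm \<Rightarrow> nat \<Rightarrow> nat \<Rightarrow> bool" where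
  "solves_convergence A n f \<longleftrightarrow>
     (\<forall>B delta sigma S pos. execution A n f B delta sigma S pos \<longrightarrow>
        (\<forall>\<epsilon>>0. \<exists>T. \<forall>t>T. \<forall>i<n. \<forall>j<n. i \<notin> B \<longrightarrow> j \<notin> B \<longrightarrow>
            \<bar>pos t i - pos t j\<bar> \<le> \<epsilon>))"

end

theory Submission
  imports Defs
begin

text \<open>
  Write \<open>n = p + q + r\<close> with \<open>r \<le> f\<close>, \<open>r \<le> p \<le> q \<le> r + f\<close>, and say that a robot steps when it
  belongs to one of two groups of sizes \<open>p\<close> and \<open>q\<close> at distance \<open>d\<close>, the other \<open>r\<close> robots sitting
  together anywhere; by caution it moves towards the other group without passing it.

  If the \<open>r\<close> robots are Byzantine and the two groups step in turn, with opposite orientations, then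
  the step seen by either group depends only on \<open>d\<close>, on the relative position of the Byzantine robots,
  and on which of the sizes \<open>p\<close>, \<open>q\<close> belongs to the mover. Convergence therefore forces every orbit
  \<open>d \<mapsto> d - step\<close> with alternating sizes to come arbitrarily close to \<open>0\<close>, whoever performs the steps.

  Now take two correct groups \<open>L\<close>, \<open>R\<close> of size \<open>r\<close>, a correct group \<open>M\<close> of size \<open>p\<close>, and \<open>q - r\<close>
  Byzantine robots. With the Byzantine robots at \<open>R\<close> (\<open>q - p\<close> of them at \<open>M\<close> in every other round),
  activating \<open>M\<close> alone performs exactly such an orbit, so \<open>M\<close> comes as close to \<open>R\<close> as desired. Then
  \<open>R\<close> can be activated: as \<open>L\<close> might be Byzantine, caution keeps \<open>R\<close> between its position and \<open>M\<close>.
  The same is done with \<open>L\<close> in place of \<open>R\<close>, and so on with summable losses, so that the distance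
  between \<open>L\<close> and \<open>R\<close> stays bounded below.
\<close>

section \<open>Views and caution with three occupied points\<close>

lemma config_three_points:
  assumes "{..<n} = P \<union> Q \<union> X" "P \<inter> Q = {}" "P \<inter> X = {}" "Q \<inter> X = {}"
    and "\<And>j. j \<in> P \<Longrightarrow> pos j = u" "\<And>j. j \<in> Q \<Longrightarrow> pos j = v" "\<And>j. j \<in> X \<Longrightarrow> pos j = y"
  shows "config n pos
    = replicate_mset (card P) u + replicate_mset (card Q) v + replicate_mset (card X) y"
proof -
  have fin: "finite P" "finite Q" "finite X"
    using assms(1) finite_lessThan[of n] by (metis finite_Un)+
  have const: "image_mset pos (mset_set C) = replicate_mset (card C) w"
    if "\<And>j. j \<in> C \<Longrightarrow> pos j = w" "finite C" for C w
  proof -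
    have "image_mset pos (mset_set C) = image_mset (\<lambda>_. w) (mset_set C)"
      using that by (intro image_mset_cong) auto
    then show ?thesis by (simp add: image_mset_const_eq)
  qed
  have "mset_set {..<n} = mset_set P + mset_set Q + mset_set X"
    using assms(2-4) fin unfolding assms(1)
    by (subst mset_set_Union, auto)+
  then show ?thesis
    unfolding config_def using assms(5-7) fin const by simp
qed

lemma dest_three_points:
  assumes "{..<n} = P \<union> Q \<union> X" "P \<inter> Q = {}" "P \<inter> X = {}" "Q \<inter> X = {}"
    and "\<And>j. j \<in> P \<Longrightarrow> pos j = u" "\<And>j. j \<in> Q \<Longrightarrow> pos j = v" "\<And>j. j \<in> X \<Longrightarrow> pos j = y"
    and "i \<in> P"
  shows "dest A n pos s i = u + s * A (replicate_mset (card P) 0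
    + replicate_mset (card Q) (s * (v - u)) + replicate_mset (card X) (s * (y - u)))"
  using assms(5)[OF assms(8)] config_three_points[OF assms(1-7)]
  by (simp add: dest_def local_view_def)

text \<open>Caution only speaks about executions, but every configuration starts one: activate all
  robots in every round and let each reach its destination.\<close>

lemma cautious_dest_in_range:
  assumes "cautious A n f" "B \<subseteq> {..<n}" "card B \<le> f" "i < n" "i \<notin> B" "s = 1 \<or> s = -1"
  shows "dest A n p s i \<in> {Min (correct_positions n B p) .. Max (correct_positions n B p)}"
proof -
  define pos where "pos = rec_nat p (\<lambda>t q j. dest A n q s j)"
  have pos: "pos 0 = p" "\<And>t. pos (Suc t) = (\<lambda>j. dest A n (pos t) s j)"
    by (simp_all add: pos_def)
  have "execution A n f B (\<lambda>_. 1) (\<lambda>_. s) (\<lambda>_. {..<n}) pos"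
    using assms(2,3,6) by (auto simp: execution_def pos(2) Let_def)
  then have "dest A n (pos 0) s i
      \<in> {Min (correct_positions n B (pos 0)) .. Max (correct_positions n B (pos 0))}"
    using assms(1,4,5) unfolding cautious_def by blast
  then show ?thesis by (simp add: pos(1))
qed

text \<open>The \<open>r\<close> robots at \<open>x\<close> may be the Byzantine ones, which leaves
  only \<open>0\<close> and \<open>d\<close> as correct positions.\<close>

lemma cautious_three_points:
  assumes "cautious A n f" "a + b + r = n" "1 \<le> a" "1 \<le> b" "r \<le> f"
  shows "A (replicate_mset a 0 + replicate_mset b d + replicate_mset r x) \<in> {min 0 d .. max 0 d}"
proof -
  define p where "p = (\<lambda>j. if j < a then 0 else if j < a + b then d else x)"
  have "dest A n p 1 0 = 0 + 1 * A (replicate_mset (card {..<a}) 0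
      + replicate_mset (card {a..<a+b}) (1 * (d - 0))
      + replicate_mset (card {a+b..<n}) (1 * (x - 0)))"
    using assms by (intro dest_three_points) (auto simp: p_def)
  moreover have "n - (a + b) = r" using assms by simp
  moreover have "correct_positions n {a+b..<n} p = {0, d}"
  proof -
    have "{..<n} - {a+b..<n} = {..<a} \<union> {a..<a+b}" using assms by auto
    moreover have "p ` {..<a} = {0}"
    proof -
      have "0 \<in> {..<a}" using assms by simp
      then show ?thesis by (force simp: p_def)
    qed
    moreover have "p ` {a..<a+b} = {d}"
    proof -
      have "a \<in> {a..<a+b}" using assms by simp
      then show ?thesis by (force simp: p_def)
    qed
    ultimately show ?thesis by (auto simp: correct_positions_def image_Un)
  qed
  moreover have "dest A n p 1 0 \<in> {Min (correct_positions n {a+b..<n} p) ..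
      Max (correct_positions n {a+b..<n} p)}"
    using assms by (intro cautious_dest_in_range[of A n f]) auto
  ultimately show ?thesis by simp
qed

section \<open>Orbits of two correct groups\<close>

text \<open>Here \<open>d\<close> is the signed gap between groups \<open>P\<close> at
  \<open>u\<close> and \<open>Q\<close> at \<open>v\<close>. Opposite orientations let the mover of
  either group see the other one at local coordinate \<open>d k\<close>, so either kind of move
  shortens the gap by the value of \<open>A\<close>.\<close>

lemma two_groups_orbit_gets_small:
  fixes d x :: "nat \<Rightarrow> real" and ty :: "nat \<Rightarrow> bool"
  assumes conv: "solves_convergence A n f"
    and n: "p + q + r = n" "1 \<le> p" "1 \<le> q" "r \<le> f"
    and inf: "\<And>s t. \<exists>t'\<ge>t. ty t' = s"
    and step: "\<And>k. d (Suc k) = d k - (if ty k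
      then A (replicate_mset p 0 + replicate_mset q (d k) + replicate_mset r (x k))
      else A (replicate_mset q 0 + replicate_mset p (d k) + replicate_mset r (x k)))"
    and "\<epsilon> > 0"
  shows "\<exists>k. \<bar>d k\<bar> \<le> \<epsilon>"
proof -
  define F where "F k = (if ty k
      then A (replicate_mset p 0 + replicate_mset q (d k) + replicate_mset r (x k))
      else A (replicate_mset q 0 + replicate_mset p (d k) + replicate_mset r (x k)))" for k
  define u where "u = rec_nat 0 (\<lambda>k w. if ty k then w + F k else w)"
  have u: "u (Suc k) = (if ty k then u k + F k else u k)" for k by (simp add: u_def)
  define v where "v k = u k + d k" for k
  have v: "v (Suc k) = (if ty k then v k else v k - F k)" for k
    using step[of k] u[of k] by (simp add: v_def F_def)
  \<comment> \<open>The Byzantine robots sit at coordinate \<open>x k\<close> in the local frame of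
    whichever group moves.\<close>
  define y where "y k = (if ty k then u k + x k else v k - x k)" for k
  define P Q X where "P = {..<p}" and "Q = {p..<p+q}" and "X = {p+q..<n}"
  have part: "{..<n} = P \<union> Q \<union> X" "P \<inter> Q = {}" "P \<inter> X = {}" "Q \<inter> X = {}"
    and card: "card P = p" "card Q = q" "card X = r"
    using n by (auto simp: P_def Q_def X_def)
  define pos where "pos k j = (if j \<in> P then u k else if j \<in> Q then v k else y k)" for k j
  define sigma :: "nat \<Rightarrow> real" where "sigma j = (if j \<in> P then 1 else -1)" for j
  have posP: "j \<in> P \<Longrightarrow> pos k j = u k" and posQ: "j \<in> Q \<Longrightarrow> pos k j = v k"
    and posX: "j \<in> X \<Longrightarrow> pos k j = y k" for j k
    using part by (auto simp: pos_def)
  have dP: "dest A n (pos k) 1 j = u k + F k" if "j \<in> P" "ty k" for j k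
    using dest_three_points[OF part, of "pos k" "u k" "v k" "y k" j A 1] posP posQ posX that
    by (simp add: card F_def y_def v_def)
  have part': "{..<n} = Q \<union> P \<union> X" "Q \<inter> P = {}" using part by auto
  have dQ: "dest A n (pos k) (-1) j = v k - F k" if "j \<in> Q" "\<not> ty k" for j k
    using dest_three_points[OF part' part(4,3), of "pos k" "v k" "u k" "y k" j A "-1"]
      posP posQ posX that
    by (simp add: card F_def y_def v_def)
  \<comment> \<open>Fairness also covers the Byzantine robots, hence \<open>X\<close> in every
    round.\<close>
  define S where "S k = (if ty k then P else Q) \<union> X" for k
  have "execution A n f X (\<lambda>_. 1) sigma S pos"
    unfolding execution_def
  proof (intro conjI allI impI)
    show "X \<subseteq> {..<n}" "card X \<le> f" using part card n by auto
    show "S t \<subseteq> {..<n}" for t using part by (auto simp: S_def)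
    show "sigma i = 1 \<or> sigma i = - 1" for i by (simp add: sigma_def)
    show "\<exists>t'\<ge>t. i \<in> S t'" if "i < n" for i t
    proof -
      have "i \<in> P \<or> i \<in> Q \<or> i \<in> X" using that part(1) by auto
      then show ?thesis
        using inf[of t True] inf[of t False] by (auto simp: S_def)
    qed
  next
    fix t i assume "i < n" "i \<notin> X"
    then have "i \<in> P \<or> i \<in> Q" using part(1) by auto
    then show "if i \<in> S t then
        let p = pos t i; d = dest A n (pos t) (sigma i) i; q = pos (Suc t) i in
          min p d \<le> q \<and> q \<le> max p d \<and> (q = d \<or> 1 \<le> \<bar>q - p\<bar>)
      else pos (Suc t) i = pos t i"
    proof
      assume i: "i \<in> P"
      then have "i \<in> S t \<longleftrightarrow> ty t" using part by (auto simp: S_def)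
      then show ?thesis using i posP dP[OF i] u by (simp add: sigma_def Let_def)
    next
      assume i: "i \<in> Q"
      then have "i \<in> S t \<longleftrightarrow> \<not> ty t" "i \<notin> P" using part by (auto simp: S_def)
      then show ?thesis using i posQ dQ[OF i] v by (simp add: sigma_def Let_def)
    qed
  qed simp
  then obtain T where T: "\<And>t i j. t > T \<Longrightarrow> i < n \<Longrightarrow> j < n \<Longrightarrow> i \<notin> X \<Longrightarrow> j \<notin> X
      \<Longrightarrow> \<bar>pos t i - pos t j\<bar> \<le> \<epsilon>"
    using conv \<open>\<epsilon> > 0\<close> unfolding solves_convergence_def by blast
  have "\<bar>pos (Suc T) p - pos (Suc T) 0\<bar> \<le> \<epsilon>"
    using n by (intro T) (auto simp: X_def)
  moreover have "pos (Suc T) p = v (Suc T)" "pos (Suc T) 0 = u (Suc T)"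
    using n by (auto intro!: posP posQ simp: P_def Q_def)
  ultimately show ?thesis by (auto simp: v_def)
qed

section \<open>The back-and-forth motion as a recursion on reals\<close>

text \<open>The middle group \<open>m\<close> runs back and forth between the two stalled groups at \<open>c True\<close> and
  \<open>c False\<close>; \<open>mode\<close> is the current target, and \<open>flip\<close> marks the rounds in which the target is close
  enough to be activated as well. Since \<open>m\<close> may then overtake the target, no order of the three
  positions is maintained.\<close>

lemma shuttle_exists:
  fixes F :: "bool \<Rightarrow> real \<Rightarrow> real \<Rightarrow> real"
  assumes range: "\<And>ty d x. F ty d x \<in> {min 0 d .. max 0 d}"
    and orbit: "\<And>d x ty \<epsilon>. (\<And>s t. \<exists>t'\<ge>t. ty t' = s) \<Longrightarrow>
      (\<And>k::nat. d (Suc k) = d k - F (ty k) (d k) (x k)) \<Longrightarrow> (\<epsilon>::real) > 0 \<Longrightarrow> \<exists>k. \<bar>d k\<bar> \<le> \<epsilon>"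
  obtains m :: "nat \<Rightarrow> real" and c :: "nat \<Rightarrow> bool \<Rightarrow> real" and mode flip :: "nat \<Rightarrow> bool"
  where "\<And>t. m (Suc t) = m t + F (even t) (c t (mode t) - m t) (c t (\<not> mode t) - m t)"
    and "\<And>t s. c (Suc t) s = (if flip t \<and> s = mode t
      then c t s + F (odd t) (m t - c t s) (c t (\<not> s) - c t s) else c t s)"
    and "\<And>t. \<bar>c t True - c t False\<bar> \<ge> 1/2"
    and "\<And>s t. \<exists>t'\<ge>t. flip t' \<and> mode t' = s"
proof -
  \<comment> \<open>The number \<open>h\<close> of earlier flips sets the tolerance: losses of at
    most 1/4, 1/8, ... sum to 1/2, out of an initial distance 1.\<close>
  define cl :: "real \<Rightarrow> (bool \<Rightarrow> real) \<Rightarrow> bool \<Rightarrow> nat \<Rightarrow> bool"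
    where "cl m c b h \<longleftrightarrow> \<bar>c b - m\<bar> \<le> (1/2) ^ (h + 2)" for m c b h
  \<comment> \<open>The flag of \<open>F\<close> tells which size the mover's side has. The two
    sides swap sizes every round, hence \<open>even t\<close> for the middle and
    \<open>odd t\<close> for the target.\<close>
  define st :: "nat \<Rightarrow> real \<times> (bool \<Rightarrow> real) \<times> bool \<times> nat" where
    "st = rec_nat (0, (\<lambda>s. if s then 1 else 0), True, 0) (\<lambda>t (m, c, b, h).
       (m + F (even t) (c b - m) (c (\<not> b) - m),
        (\<lambda>s. if cl m c b h \<and> s = b then c s + F (odd t) (m - c s) (c (\<not> s) - c s) else c s),
        (b \<noteq> cl m c b h),
        (if cl m c b h then Suc h else h)))"
  define m where "m t = fst (st t)" for t
  define c where "c t = fst (snd (st t))" for t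
  define mode where "mode t = fst (snd (snd (st t)))" for t
  define h where "h t = snd (snd (snd (st t)))" for t
  define flip where "flip t = cl (m t) (c t) (mode t) (h t)" for t
  note defs = m_def c_def mode_def h_def flip_def
  have m: "m (Suc t) = m t + F (even t) (c t (mode t) - m t) (c t (\<not> mode t) - m t)" for t
    by (simp add: defs st_def split: prod.split)
  have c: "c (Suc t) s = (if flip t \<and> s = mode t
      then c t s + F (odd t) (m t - c t s) (c t (\<not> s) - c t s) else c t s)" for t s
    by (simp add: defs st_def split: prod.split)
  have mode: "mode (Suc t) = (mode t \<noteq> flip t)" for t
    by (simp add: defs st_def split: prod.split)
  have h: "h (Suc t) = (if flip t then Suc (h t) else h t)" for t
    by (simp add: defs st_def split: prod.split)
  have init: "c 0 = (\<lambda>s. if s then 1 else 0)" "h 0 = 0"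
    by (simp_all add: defs st_def)
  \<comment> \<open>The power is the sum of the bounds on all losses still to come.\<close>
  have gap: "\<bar>c t True - c t False\<bar> \<ge> 1/2 + (1/2) ^ (h t + 1)" for t
  proof (induction t)
    case 0
    then show ?case by (simp add: init)
  next
    case (Suc t)
    show ?case
    proof (cases "flip t")
      case False
      then show ?thesis using Suc by (simp add: c h)
    next
      case True
      then have "\<bar>c t (mode t) - m t\<bar> \<le> (1/2) ^ (h t + 2)" by (simp add: flip_def cl_def)
      moreover have "\<bar>F (odd t) (m t - c t (mode t)) y\<bar> \<le> \<bar>c t (mode t) - m t\<bar>" for y
        using range[of "odd t" "m t - c t (mode t)" y] by (auto simp: min_def max_def split: if_splits)
      ultimately have le: "\<bar>F (odd t) (m t - c t (mode t)) y\<bar> \<le> (1/2) ^ (h t + 2)" for y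
        using order_trans by blast
      have "h (Suc t) = Suc (h t)" using True h by simp
      then have hh: "(1/2::real) ^ (h t + 1) = 2 * (1/2) ^ (h t + 2)"
        "(1/2::real) ^ (h (Suc t) + 1) = (1/2) ^ (h t + 2)" by simp_all
      show ?thesis
      proof (cases "mode t")
        case True
        then have "c (Suc t) True = c t True + F (odd t) (m t - c t True) (c t False - c t True)"
          "c (Suc t) False = c t False" using \<open>flip t\<close> by (simp_all add: c)
        then show ?thesis using Suc le[of "c t False - c t True"] True hh by simp
      next
        case False
        then have "c (Suc t) False = c t False + F (odd t) (m t - c t False) (c t True - c t False)"
          "c (Suc t) True = c t True" using \<open>flip t\<close> by (simp_all add: c)
        then show ?thesis using Suc le[of "c t True - c t False"] False hh by simp
      qed
    qed
  qed
  \<comment> \<open>Without further flips the target and the far group are frozen, so the gap from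
    \<open>m\<close> to the target follows an orbit with alternating flags and must fall below the
    fixed tolerance.\<close>
  have flips: "\<exists>t'\<ge>t. flip t'" for t
  proof (rule ccontr)
    assume "\<not> ?thesis"
    then have no: "\<not> flip (t + k)" for k by simp
    have const: "mode (t + k) = mode t \<and> c (t + k) = c t \<and> h (t + k) = h t" for k
      by (induction k) (use no in \<open>auto simp: mode c h\<close>)
    let ?d = "\<lambda>k. c t (mode t) - m (t + k)"
    have "\<exists>k. \<bar>?d k\<bar> \<le> (1/2) ^ (h t + 2)"
    proof (rule orbit)
      show "\<exists>t''\<ge>t'. even (t + t'') = s" for s t'
        by (cases "even (t + t') = s") (auto intro: exI[of _ t'] exI[of _ "Suc t'"])
      show "?d (Suc k) = ?d k - F (even (t + k)) (?d k) (c t (\<not> mode t) - m (t + k))" for k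
        using m[of "t + k"] const[of k] by simp
    qed simp
    then show False using no const by (auto simp: flip_def cl_def)
  qed
  \<comment> \<open>Only a flip changes \<open>mode\<close>, so the first flip from \<open>t\<close>
    on still has target \<open>mode t\<close>; the one after it has the opposite target.\<close>
  have next_flip: "\<exists>t'\<ge>t. flip t' \<and> mode t' = mode t" for t
  proof -
    define k where "k = (LEAST k. flip (t + k))"
    have "\<exists>k. flip (t + k)" using flips[of t] by (auto simp: le_iff_add)
    then have k: "flip (t + k)" unfolding k_def by (rule LeastI_ex)
    have "j \<le> k \<Longrightarrow> mode (t + j) = mode t" for j
    proof (induction j)
      case (Suc j)
      then have "\<not> flip (t + j)" using not_less_Least[of j "\<lambda>k. flip (t + k)"] by (simp add: k_def)
      then show ?case using Suc by (simp add: mode)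
    qed simp
    then show ?thesis using k by (intro exI[of _ "t + k"]) simp
  qed
  have "\<exists>t'\<ge>t. flip t' \<and> mode t' = s" for s t
  proof -
    obtain t1 where t1: "t1 \<ge> t" "flip t1" "mode t1 = mode t" using next_flip by blast
    obtain t2 where t2: "t2 \<ge> Suc t1" "flip t2" "mode t2 = mode (Suc t1)" using next_flip by blast
    then have "mode t2 = (\<not> mode t1)" using t1 mode by simp
    then show ?thesis using t1 t2 by (cases "mode t1 = s") (auto intro: exI[of _ t1] exI[of _ t2])
  qed
  moreover have "\<bar>c t True - c t False\<bar> \<ge> 1/2" for t
    using gap[of t] zero_le_power[of "1/2::real" "h t + 1"] by linarith
  ultimately show ?thesis by (intro that[OF m c])
qed

section \<open>Two stalled groups and a shuttling middle\<close>

lemma three_groups_impossible: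
  assumes caut: "cautious A n f" and conv: "solves_convergence A n f"
    and n: "p + q + r = n" "1 \<le> r" "r \<le> p" "p \<le> q" "r \<le> f" "q \<le> r + f"
  shows False
proof -
  define F where "F ty d x = (if ty
      then A (replicate_mset p 0 + replicate_mset q d + replicate_mset r x)
      else A (replicate_mset q 0 + replicate_mset p d + replicate_mset r x))" for ty d x
  have range: "F ty d x \<in> {min 0 d .. max 0 d}" for ty d x
    unfolding F_def using n
    by (simp only: split: if_split) (intro conjI impI cautious_three_points[OF caut]; simp)
  obtain m c mode flip
    where m: "\<And>t. m (Suc t) = m t + F (even t) (c t (mode t) - m t) (c t (\<not> mode t) - m t)"
      and c: "\<And>t s. c (Suc t) s = (if flip t \<and> s = mode t
        then c t s + F (odd t) (m t - c t s) (c t (\<not> s) - c t s) else c t s)"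
      and gap: "\<And>t. \<bar>c t True - c t False\<bar> \<ge> 1/2"
      and flips: "\<And>s t. \<exists>t'\<ge>t. flip t' \<and> mode t' = s"
  proof (rule shuttle_exists[of F])
    show "F ty d x \<in> {min 0 d .. max 0 d}" for ty d x by (rule range)
    show "\<exists>k. \<bar>d k\<bar> \<le> \<epsilon>"
      if "\<And>s t. \<exists>t'\<ge>t. ty t' = s" "\<And>k. d (Suc k) = d k - F (ty k) (d k) (x k)" "0 < \<epsilon>"
      for d x :: "nat \<Rightarrow> real" and ty \<epsilon>
      by (rule two_groups_orbit_gets_small[OF conv n(1), where ty = ty and x = x])
        (use n that in \<open>simp_all add: F_def\<close>)
  qed blast
  define C where "C s = (if s then {r..<2*r} else {..<r})" for s
  \<comment> \<open>The Byzantine set has (q - p) + (p - r) = q - r \<le> f robots. \<open>V\<close>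
    always fills the target up to \<open>p\<close>; \<open>W\<close> raises the target to
    \<open>q\<close> in even rounds and the middle to \<open>q\<close> in odd ones.\<close>
  define M W V where "M = {2*r..<2*r+p}" and "W = {2*r+p..<2*r+q}" and "V = {2*r+q..<n}"
  have cards: "card (C s) = r" "card M = p" "card W = q - p" "card V = p - r" for s
    using n by (auto simp: C_def M_def W_def V_def)
  have fin: "finite (C s)" "finite M" "finite W" "finite V" for s
    by (auto simp: C_def M_def W_def V_def)
  have dj: "C s \<inter> C (\<not> s) = {}" "C s \<inter> M = {}" "C s \<inter> W = {}" "C s \<inter> V = {}"
    and djM: "M \<inter> W = {}" "M \<inter> V = {}" "W \<inter> V = {}"
    and un: "{..<n} = C s \<union> C (\<not> s) \<union> M \<union> W \<union> V" for s
    using n by (auto simp: C_def M_def W_def V_def)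
  define pos where "pos t j = (if j \<in> C True then c t True else if j \<in> C False then c t False
      else if j \<in> M \<or> odd t \<and> j \<in> W then m t else c t (mode t))" for t j
  have posC: "j \<in> C s \<Longrightarrow> pos t j = c t s" and posM: "j \<in> M \<Longrightarrow> pos t j = m t"
    and posW: "j \<in> W \<Longrightarrow> pos t j = (if even t then c t (mode t) else m t)"
    and posV: "j \<in> V \<Longrightarrow> pos t j = c t (mode t)" for s j t
    using dj[of True] dj[of False] djM by (cases s; auto simp: pos_def)+
  define Mid where "Mid t = (if even t then M else M \<union> W)" for t :: nat
  define Tgt where "Tgt t = C (mode t) \<union> V \<union> (if even t then W else {})" for t
  define Far where "Far t = C (\<not> mode t)" for t
  have part: "{..<n} = Mid t \<union> Tgt t \<union> Far t" "Mid t \<inter> Tgt t = {}" "Mid t \<inter> Far t = {}" "Tgt t \<inter> Far t = {}"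
    for t
    using un[of "mode t"] dj[of "mode t"] dj[of "\<not> mode t"] djM
    by (auto simp: Mid_def Tgt_def Far_def)
  have card: "card (Mid t) = (if even t then p else q)" "card (Tgt t) = (if even t then q else p)"
      "card (Far t) = r" for t
    using n dj[of "mode t"] djM fin cards
    by (auto simp: Mid_def Tgt_def Far_def card_Un_disjoint Int_Un_distrib2 Int_commute)
  have at: "j \<in> Mid t \<Longrightarrow> pos t j = m t" "j \<in> Tgt t \<Longrightarrow> pos t j = c t (mode t)"
      "j \<in> Far t \<Longrightarrow> pos t j = c t (\<not> mode t)" for j t
    using posC posM posW posV by (auto simp: Mid_def Tgt_def Far_def split: if_splits)
  have Mid: "j \<in> M \<Longrightarrow> j \<in> Mid t" and Tgt: "j \<in> C (mode t) \<Longrightarrow> j \<in> Tgt t" for j t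
    by (auto simp: Mid_def Tgt_def)
  have destM: "dest A n (pos t) 1 j = m (Suc t)" if "j \<in> M" for j t
    using dest_three_points[OF part[of t], of "pos t" "m t" "c t (mode t)" "c t (\<not> mode t)" j A 1]
      at that Mid[OF that]
    by (cases "even t") (simp_all add: card m F_def)
  have part': "{..<n} = Tgt t \<union> Mid t \<union> Far t" "Tgt t \<inter> Mid t = {}" for t
    using part[of t] by auto
  have destC: "dest A n (pos t) 1 j = c (Suc t) (mode t)" if "j \<in> C (mode t)" "flip t" for j t
    using dest_three_points[OF part'[of t] part(4,3)[of t], of "pos t" "c t (mode t)" "m t" "c t (\<not> mode t)" j A 1]
      at that Tgt[OF that(1)]
    by (cases "even t") (simp_all add: card c F_def)
  define S where "S t = M \<union> W \<union> V \<union> (if flip t then C (mode t) else {})" for t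
  have "execution A n f (W \<union> V) (\<lambda>_. 1) (\<lambda>_. 1) S pos"
    unfolding execution_def
  proof (intro conjI allI impI)
    show "W \<union> V \<subseteq> {..<n}" using un[of True] by auto
    show "card (W \<union> V) \<le> f" using n cards djM fin by (simp add: card_Un_disjoint)
    show "S t \<subseteq> {..<n}" for t using un[of "mode t"] by (auto simp: S_def)
    show "\<exists>t'\<ge>t. i \<in> S t'" if "i < n" for i t
    proof -
      have "i \<in> C True \<or> i \<in> C False \<or> i \<in> M \<union> W \<union> V" using that un[of True] by auto
      then show ?thesis
        using flips[of t True] flips[of t False] by (auto simp: S_def)
    qed
  next
    fix t i assume "i < n" "i \<notin> W \<union> V"
    then consider "i \<in> M" | s where "i \<in> C s" using un[of True] by auto
    then show "if i \<in> S t then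
        let p = pos t i; d = dest A n (pos t) 1 i; q = pos (Suc t) i in
          min p d \<le> q \<and> q \<le> max p d \<and> (q = d \<or> 1 \<le> \<bar>q - p\<bar>)
      else pos (Suc t) i = pos t i"
    proof cases
      case 1
      then show ?thesis by (simp add: S_def Let_def destM posM)
    next
      case 2
      then have "i \<in> S t \<longleftrightarrow> flip t \<and> mode t = s"
        using dj[of s] djM by (cases "mode t = s") (auto simp: S_def)
      then show ?thesis using 2 posC[OF 2] destC[of i t] c[of t s] by (auto simp: Let_def)
    qed
  qed auto
  moreover have "(1/4::real) > 0" by simp
  ultimately obtain T where T: "\<And>t i j. t > T \<Longrightarrow> i < n \<Longrightarrow> j < n \<Longrightarrow> i \<notin> W \<union> V \<Longrightarrow> j \<notin> W \<union> V
      \<Longrightarrow> \<bar>pos t i - pos t j\<bar> \<le> 1/4"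
    using conv unfolding solves_convergence_def by blast
  have "\<bar>pos (Suc T) r - pos (Suc T) 0\<bar> \<le> 1/4"
    using n by (intro T) (auto simp: W_def V_def)
  moreover have "pos (Suc T) r = c (Suc T) True" "pos (Suc T) 0 = c (Suc T) False"
    using n by (auto intro!: posC simp: C_def)
  ultimately show False using gap[of "Suc T"] by simp
qed

text \<open>Two robots are too few for three nonempty groups. But each must allow for the other
  being Byzantine, so caution pins both where they are.\<close>

lemma two_robots_impossible:
  assumes caut: "cautious A 2 f" and conv: "solves_convergence A 2 f" and "f \<ge> 1"
  shows False
proof -
  have stay: "dest A 2 real 1 i = real i" if "i < 2" for i
  proof -
    have B: "{..<2} - {1 - i} = {i}" "1 - i < 2" "i \<noteq> 1 - i" using that by (auto, presburger+)
    have "dest A 2 real 1 i \<in> {Min (correct_positions 2 {1 - i} real) ..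
        Max (correct_positions 2 {1 - i} real)}"
      using B that \<open>f \<ge> 1\<close> by (intro cautious_dest_in_range[OF caut]) simp_all
    then show ?thesis unfolding correct_positions_def B(1) by simp
  qed
  have "execution A 2 f {} (\<lambda>_. 1) (\<lambda>_. 1) (\<lambda>_. {..<2}) (\<lambda>_. real)"
    by (auto simp: execution_def stay Let_def)
  moreover have "(1/2::real) > 0" by simp
  ultimately obtain T :: nat where
    "\<And>t i j. t > T \<Longrightarrow> i < 2 \<Longrightarrow> j < 2 \<Longrightarrow> \<bar>real i - real j\<bar> \<le> 1/2"
    using conv unfolding solves_convergence_def by blast
  from this[of "Suc T" 0 1] show False by simp
qed

theorem theorem1:
  fixes n f :: nat
  assumes "f \<ge> 1" and "n \<ge> 2" and "n \<le> 5 * f"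
  shows "\<not> (\<exists>A :: algorithm. cautious A n f \<and> solves_convergence A n f)"
proof
  assume "\<exists>A :: algorithm. cautious A n f \<and> solves_convergence A n f"
  then obtain A where A: "cautious A n f" "solves_convergence A n f" by blast
  show False
  proof (cases "n = 2")
    case True
    then show False using A two_robots_impossible assms(1) by blast
  next
    case False
    \<comment> \<open>Splitting n - r in halves works if 3r \<le> n \<le> 3r + 2f. For r = f the
      upper bound is n \<le> 5f; for r = n div 3 it follows from n \<le> 3r + 2.\<close>
    define r where "r = min f (n div 3)"
    define p where "p = (n - r) div 2"
    define q where "q = n - r - p"
    have "1 \<le> r" "r \<le> f" "3 * r \<le> n" "n \<le> 3 * r + 2 * f"
      using assms False by (auto simp: r_def min_def)
    then have "p + q + r = n" "r \<le> p" "p \<le> q" "q \<le> r + f"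
      by (auto simp: p_def q_def)
    then show False
      using three_groups_impossible[OF A] \<open>1 \<le> r\<close> \<open>r \<le> f\<close> by blast
  qed
qed

end
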